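(* Let $\tau \ge 0$ and let $\mathbf{L}\in\mathbb{R}^{n\times n}$ be a symmetric positive semi-definite matrix with largest eigenvalue $\lambda_{\max}=2$. Let $K\ge 0$ be an integer with $K > \tau/2-1$, and let $p_K$ be the order-$K$ truncated Chebyshev approximation of $\lambda\mapsto \exp(-\tau\lambda)$ on $[0,2]$. Then for every nonzero $x\in\mathbb{R}^n$, $$\frac{\|\exp(-\tau\mathbf{L})x - p_K(\mathbf{L})x\|_2^2}{\|x\|_2^2} \ \le\ g^2(K,\tau)$$ and $$\frac{\|\exp(-\tau\mathbf{L})x - p_K(\mathbf{L})x\|_2^2}{\|\exp(-\tau\mathbf{L})x\|_2^2} \ \le\ g^2(K,\tau)\, e^{4\tau},$$ where $$g(K,\tau) := 2\, e^{\frac{(\tau/2)^2}{K+2}-\tau}\, \frac{(\tau/2)^{K+1}}{K!\,(K+1-\tau/2)}.$$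
   Context: The polynomial $p_K$ is $p_K(\lambda) = \tfrac12 c_0(\tau) + \sum_{k=1}^{K} c_k(\tau)\, T_k(\lambda-1)$, where $T_k$ is the Chebyshev polynomial of the first kind ($T_k(\cos\theta)=\cos(k\theta)$) and $c_k(\tau) = \frac{2}{\pi}\int_0^{\pi} \cos(k\theta) \exp(-\tau(\cos\theta+1))\,\mathrm{d}\theta$. For a symmetric matrix $\mathbf{L}=\mathbf{U}\,\mathrm{diag}(\lambda_i)\,\mathbf{U}^\top$ ($\mathbf{U}$ orthogonal) and a function $f$, $f(\mathbf{L}) := \mathbf{U}\,\mathrm{diag}(f(\lambda_i))\,\mathbf{U}^\top$, which agrees with the usual matrix polynomial and matrix exponential. *)

theory Defs
  imports "HOL-Analysis.Analysis" "HOL-Computational_Algebra.Polynomial"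
begin

section \<open>Symmetric matrices\<close>

definition psd_matrix :: "real ^ 'n ^ 'n \<Rightarrow> bool" where
  "psd_matrix A \<longleftrightarrow> transpose A = A \<and> (\<forall>x. 0 \<le> x \<bullet> (A *v x))"

definition matrix_eigenvalue :: "real ^ 'n ^ 'n \<Rightarrow> real \<Rightarrow> bool" where
  "matrix_eigenvalue A \<mu> \<longleftrightarrow> (\<exists>v. v \<noteq> 0 \<and> A *v v = \<mu> *\<^sub>R v)"

definition largest_eigenvalue :: "real ^ 'n ^ 'n \<Rightarrow> real \<Rightarrow> bool" where
  "largest_eigenvalue A \<mu> \<longleftrightarrow>
     matrix_eigenvalue A \<mu> \<and> (\<forall>\<nu>. matrix_eigenvalue A \<nu> \<longrightarrow> \<nu> \<le> \<mu>)"

definition diag_matrix :: "real ^ 'n \<Rightarrow> real ^ 'n ^ 'n" where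
  "diag_matrix d = (\<chi> i j. if i = j then d $ i else 0)"

definition spectral_decomp :: "real ^ 'n ^ 'n \<Rightarrow> real ^ 'n ^ 'n \<Rightarrow> real ^ 'n \<Rightarrow> bool" where
  "spectral_decomp A U d \<longleftrightarrow>
     orthogonal_matrix U \<and> A = U ** diag_matrix d ** transpose U"

text \<open>
  The value does not depend on the decomposition, see \<open>matrix_fun_eq\<close> below. It is
  meaningful only when a decomposition exists, that is, for symmetric \<open>A\<close>.
\<close>

definition matrix_fun :: "(real \<Rightarrow> real) \<Rightarrow> real ^ 'n ^ 'n \<Rightarrow> real ^ 'n ^ 'n" where
  "matrix_fun f A = (THE B. \<exists>U d. spectral_decomp A U d \<and>
     B = U ** diag_matrix (\<chi> i. f (d $ i)) ** transpose U)"

lemma diag_matrix_mult_left: "(diag_matrix d ** M) $ i $ j = d $ i * M $ i $ j"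
  by (simp add: diag_matrix_def matrix_matrix_mult_def if_distrib[of "\<lambda>x. x * _"] sum.delta'
      cong: if_cong)

lemma diag_matrix_mult_right: "(M ** diag_matrix d) $ i $ j = M $ i $ j * d $ j"
  by (simp add: diag_matrix_def matrix_matrix_mult_def if_distrib[of "\<lambda>x. _ * x"] sum.delta
      cong: if_cong)

lemma spectral_decomp_fun_unique:
  fixes A U V :: "real ^ 'n ^ 'n"
  assumes "spectral_decomp A U d" "spectral_decomp A V e"
  shows "U ** diag_matrix (\<chi> i. f (d $ i)) ** transpose U =
         V ** diag_matrix (\<chi> i. f (e $ i)) ** transpose V"
proof -
  define W where "W = transpose V ** U"
  have U: "transpose U ** U = mat 1" "U ** transpose U = mat 1"
    and V: "transpose V ** V = mat 1" "V ** transpose V = mat 1"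
    and eq: "U ** diag_matrix d ** transpose U = V ** diag_matrix e ** transpose V"
    using assms by (auto simp: spectral_decomp_def orthogonal_matrix_def)
  have "transpose V ** (U ** diag_matrix d ** transpose U) ** U =
        transpose V ** (V ** diag_matrix e ** transpose V) ** U"
    by (simp add: eq)
  then have "W ** diag_matrix d = diag_matrix e ** W"
    using U V unfolding W_def
    by (metis matrix_mul_assoc matrix_mul_lid matrix_mul_rid)
  then have comm: "W $ i $ j * d $ j = e $ i * W $ i $ j" for i j
    by (metis diag_matrix_mult_left diag_matrix_mult_right)
  have "W $ i $ j * f (d $ j) = f (e $ i) * W $ i $ j" for i j
    using comm[of i j] by (cases "W $ i $ j = 0") (auto simp: mult.commute)
  then have W: "W ** diag_matrix (\<chi> i. f (d $ i)) = diag_matrix (\<chi> i. f (e $ i)) ** W"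
    by (simp add: vec_eq_iff diag_matrix_mult_left diag_matrix_mult_right)
  have "V ** (W ** diag_matrix (\<chi> i. f (d $ i))) ** transpose U =
        V ** (diag_matrix (\<chi> i. f (e $ i)) ** W) ** transpose U"
    by (simp add: W)
  then show ?thesis
    using U V unfolding W_def
    by (metis matrix_mul_assoc matrix_mul_lid matrix_mul_rid)
qed

lemma matrix_fun_eq:
  assumes "spectral_decomp A U d"
  shows "matrix_fun f A = U ** diag_matrix (\<chi> i. f (d $ i)) ** transpose U"
  unfolding matrix_fun_def
  using assms spectral_decomp_fun_unique by (intro the_equality) blast+


section \<open>Truncated Chebyshev approximation of the exponential\<close>

fun cheb_poly :: "nat \<Rightarrow> real poly" where
  "cheb_poly 0 = 1"
| "cheb_poly (Suc 0) = [:0, 1:]"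
| "cheb_poly (Suc (Suc k)) = [:0, 2:] * cheb_poly (Suc k) - cheb_poly k"

lemma poly_cheb_poly_cos: "poly (cheb_poly k) (cos \<theta>) = cos (real k * \<theta>)"
proof (induction k rule: cheb_poly.induct)
  case (3 k)
  have "cos (real (Suc (Suc k)) * \<theta>) + cos (real k * \<theta>) = 2 * cos (real (Suc k) * \<theta>) * cos \<theta>"
    using cos_add[of "real (Suc k) * \<theta>" \<theta>] cos_diff[of "real (Suc k) * \<theta>" \<theta>]
    by (simp add: algebra_simps)
  with 3 show ?case by (simp add: algebra_simps)
qed simp_all

definition cheb_coeff :: "real \<Rightarrow> nat \<Rightarrow> real" where
  "cheb_coeff \<tau> k = 2 / pi * integral {0..pi} (\<lambda>\<theta>. cos (real k * \<theta>) * exp (- \<tau> * (cos \<theta> + 1)))"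

definition cheb_trunc :: "nat \<Rightarrow> real \<Rightarrow> real poly" where
  "cheb_trunc K \<tau> = [: cheb_coeff \<tau> 0 / 2 :] +
     (\<Sum>k=1..K. smult (cheb_coeff \<tau> k) (pcompose (cheb_poly k) [:-1, 1:]))"

lemma poly_cheb_trunc:
  "poly (cheb_trunc K \<tau>) t =
     cheb_coeff \<tau> 0 / 2 + (\<Sum>k=1..K. cheb_coeff \<tau> k * poly (cheb_poly k) (t - 1))"
  by (simp add: cheb_trunc_def poly_sum poly_pcompose)

definition cheb_err :: "nat \<Rightarrow> real \<Rightarrow> real" where
  "cheb_err K \<tau> = 2 * exp ((\<tau> / 2)\<^sup>2 / (real K + 2) - \<tau>) *
     ((\<tau> / 2) ^ (K + 1) / (fact K * (real K + 1 - \<tau> / 2)))"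

end

(* For symmetric L both matrix functions are diagonal in the same orthonormal eigenbasis, so the first
   bound reduces to |exp(-tau t) - p_K(t)| <= g(K, tau) for t in [0, 2], and the second one follows
   from |exp(-tau L) x| >= exp(-2 tau) |x|.

   Multiplying the power series of exp(a e^{i theta}) and exp(a e^{-i theta}) gives the Jacobi-Anger
   expansion exp(2 a cos theta) = I_0(2a) + 2 sum_{k >= 1} I_k(2a) cos(k theta), so that
   c_k = 2 exp(-tau) I_k(-tau), and the error at t = cos theta + 1 is the tail of this series.  With
   s = tau / 2, |I_k(tau)| <= s^k / k! exp(s^2 / (k + 1)) bounds the tail by a geometric series of
   ratio s / (K + 1) < 1. *)

theory Submission
  imports Defs
begin

section \<open>Spectral theorem for real symmetric matrices\<close>

lemma symmetric_matrix_inner: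
  fixes A :: "real ^ 'n ^ 'n"
  assumes "transpose A = A"
  shows "(A *v x) \<bullet> y = x \<bullet> (A *v y)"
  by (metis assms dot_lmul_matrix vector_transpose_matrix)

text \<open>A maximizer \<open>v\<close> of the Rayleigh quotient on \<open>S\<close>, with maximum \<open>\<mu>\<close>, is an eigenvector: the
  quadratic form of \<open>\<mu> - A\<close> is nonnegative on \<open>S\<close> and vanishes at \<open>v\<close>, so its first variation at
  \<open>v\<close> vanishes in the direction \<open>\<mu> v - A v\<close>.\<close>

lemma symmetric_matrix_eigenvector_in_subspace:
  fixes A :: "real ^ 'n ^ 'n"
  assumes sym: "transpose A = A" and S: "subspace S" and inv: "\<And>x. x \<in> S \<Longrightarrow> A *v x \<in> S"
    and nt: "u \<in> S" "u \<noteq> 0"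
  obtains v \<mu> where "v \<in> S" "norm v = 1" "A *v v = \<mu> *\<^sub>R v"
proof -
  let ?C = "sphere 0 1 \<inter> S"
  have "compact ?C"
    by (intro compact_Int_closed compact_sphere closed_subspace S)
  moreover have "u /\<^sub>R norm u \<in> ?C"
    using nt S by (auto simp: subspace_scale)
  moreover have "continuous_on ?C (\<lambda>x. x \<bullet> (A *v x))"
    by (intro continuous_intros)
  ultimately obtain v where v: "v \<in> ?C" and max: "\<And>y. y \<in> ?C \<Longrightarrow> y \<bullet> (A *v y) \<le> v \<bullet> (A *v v)"
    using continuous_attains_sup[of ?C "\<lambda>x. x \<bullet> (A *v x)"] by blast
  define \<mu> where "\<mu> = v \<bullet> (A *v v)"
  have nv: "v \<bullet> v = 1"
    using v by (simp add: norm_eq_1)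
  \<comment> \<open>Maximality on the unit sphere extends to \<open>S\<close> because both sides are
    homogeneous of degree 2.\<close>
  have Q: "y \<bullet> (A *v y) \<le> \<mu> * (y \<bullet> y)" if "y \<in> S" for y
  proof (cases "y = 0")
    case False
    have "(y /\<^sub>R norm y) \<bullet> (A *v (y /\<^sub>R norm y)) \<le> \<mu>"
      unfolding \<mu>_def using that S False by (intro max) (auto simp: subspace_scale)
    then have "(y \<bullet> (A *v y)) / (norm y * norm y) \<le> \<mu>"
      by (simp add: matrix_vector_mult_scaleR divide_simps)
    with False show ?thesis
      by (simp add: divide_simps dot_square_norm power2_eq_square)
  qed simp
  define w where "w = \<mu> *\<^sub>R v - A *v v"
  have wS: "w \<in> S"
    unfolding w_def using v S inv by (auto intro!: subspace_diff subspace_scale)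
  define q where "q = \<mu> * (w \<bullet> w) - w \<bullet> (A *v w)"
  have "0 \<le> 2 * t * (w \<bullet> w) + t\<^sup>2 * q" for t
  proof -
    have "v + t *\<^sub>R w \<in> S"
      using v wS S by (auto intro!: subspace_add subspace_scale)
    from Q[OF this]
    have "0 \<le> \<mu> * ((v + t *\<^sub>R w) \<bullet> (v + t *\<^sub>R w)) - (v + t *\<^sub>R w) \<bullet> (A *v (v + t *\<^sub>R w))"
      by simp
    \<comment> \<open>The constant term vanishes since \<open>v \<bullet> v = 1\<close>, and
      symmetry merges the two cross terms.\<close>
    also have "\<dots> = 2 * t * (\<mu> * (v \<bullet> w) - (A *v v) \<bullet> w) + t\<^sup>2 * q"
      using nv symmetric_matrix_inner[OF sym, of v w]
      by (simp add: q_def matrix_vector_right_distrib matrix_vector_mult_scaleR inner_add_left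
          inner_add_right algebra_simps power2_eq_square inner_commute \<mu>_def)
    also have "\<mu> * (v \<bullet> w) - (A *v v) \<bullet> w = w \<bullet> w"
      by (simp add: w_def inner_diff_left)
    finally show ?thesis .
  qed
  note t = this
  have "w \<bullet> w = 0"
  proof (rule ccontr)
    assume "w \<bullet> w \<noteq> 0"
    then have p: "w \<bullet> w > 0" by simp
    \<comment> \<open>At \<open>t = - e\<close> the quadratic is
      \<open>e * (e * q) - 2 * (e * (w \<bullet> w))\<close>; this \<open>e\<close> gives
      \<open>e * q \<le> w \<bullet> w\<close>, which makes the value negative. The
      \<open>+ 1\<close> keeps the divisor positive if \<open>q = 0\<close>.\<close>
    define e where "e = (w \<bullet> w) / (\<bar>q\<bar> + 1)"
    have e: "e > 0" unfolding e_def by (intro divide_pos_pos p) auto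
    have "e * q \<le> e * (\<bar>q\<bar> + 1)"
      using e by (intro mult_left_mono) auto
    also have "\<dots> = w \<bullet> w"
      by (simp add: e_def)
    finally have "e * (e * q) \<le> e * (w \<bullet> w)"
      using e by (intro mult_left_mono) auto
    moreover have "2 * (- e) * (w \<bullet> w) + (- e)\<^sup>2 * q = e * (e * q) - 2 * (e * (w \<bullet> w))"
      by (simp add: power2_eq_square)
    moreover have "0 < e * (w \<bullet> w)"
      using e p by simp
    ultimately show False
      using t[of "- e"] by linarith
  qed
  then have "A *v v = \<mu> *\<^sub>R v" by (simp add: w_def)
  with v that show ?thesis by auto
qed

text \<open>An orthonormal set of eigenvectors of greatest cardinality spans: otherwise its
  orthogonal complement is a nonzero invariant subspace and contains a further unit
  eigenvector.\<close>

lemma symmetric_matrix_orthonormal_eigenbasis: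
  fixes A :: "real ^ 'n ^ 'n"
  assumes sym: "transpose A = A"
  obtains B where "pairwise orthogonal B" "\<And>b. b \<in> B \<Longrightarrow> norm b = 1"
    "\<And>b. b \<in> B \<Longrightarrow> \<exists>\<mu>. A *v b = \<mu> *\<^sub>R b" "card B = CARD('n)"
proof -
  define P where "P B \<longleftrightarrow> pairwise orthogonal B \<and> (\<forall>b\<in>B. norm b = 1 \<and> (\<exists>\<mu>. A *v b = \<mu> *\<^sub>R b))"
    for B :: "(real ^ 'n) set"
  have indep: "independent B" if "P B" for B
    using that unfolding P_def by (intro pairwise_orthogonal_independent) auto
  have bnd: "card B \<le> CARD('n)" if "P B" for B
    using independent_card_le[OF indep[OF that]] by simp
  have "P {}" by (simp add: P_def)
  \<comment> \<open>A greatest cardinality exists because orthonormal sets are independent, hence of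
    size at most \<open>CARD('n)\<close>.\<close>
  then obtain B where B: "P B" and max: "\<And>C. P C \<Longrightarrow> card C \<le> card B"
    using ex_has_greatest_nat[of P "{}" card "Suc CARD('n)"] by (metis bnd le_imp_less_Suc)
  have fin: "finite B" using indep[OF B] by (rule independent_imp_finite)
  have "span B = UNIV"
  proof (rule ccontr)
    assume "span B \<noteq> UNIV"
    then have "dim (span B) < DIM(real ^ 'n)"
      by (metis dim_eq_full dim_subset_UNIV dim_span span_span nat_less_le)
    then obtain u where u: "u \<noteq> 0" "\<And>y. y \<in> span B \<Longrightarrow> orthogonal u y"
      using orthogonal_to_subspace_exists[of B] by auto
    let ?S = "{x. \<forall>b\<in>B. b \<bullet> x = 0}"
    have "subspace ?S"
      by (auto simp: subspace_def inner_add_right)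
    \<comment> \<open>Symmetry moves \<open>A\<close> onto the eigenvector \<open>b\<close>:
      \<open>b \<bullet> (A *v x)\<close> is a multiple of \<open>b \<bullet> x = 0\<close>.\<close>
    moreover have "A *v x \<in> ?S" if "x \<in> ?S" for x
    proof -
      have "b \<bullet> (A *v x) = 0" if "b \<in> B" for b
        using that \<open>x \<in> ?S\<close> B symmetric_matrix_inner[OF sym, of b x] by (force simp: P_def)
      then show ?thesis by simp
    qed
    moreover have "u \<in> ?S"
      using u(2) by (auto simp: orthogonal_def inner_commute span_base)
    ultimately obtain v \<mu> where v: "v \<in> ?S" "norm v = 1" "A *v v = \<mu> *\<^sub>R v"
      using u(1) by (rule symmetric_matrix_eigenvector_in_subspace[OF sym])
    have "v \<notin> B" using v by (auto simp: norm_eq_1)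
    have "P (insert v B)"
      using B v unfolding P_def
      by (auto simp: pairwise_insert orthogonal_def inner_commute)
    from max[OF this] show False using \<open>v \<notin> B\<close> fin by simp
  qed
  then have "card B = CARD('n)"
    using dim_eq_card[of B UNIV] indep[OF B] by simp
  then show ?thesis using that[of B] B by (auto simp: P_def)
qed

text \<open>The columns of \<open>U\<close> are the eigenbasis, so
  \<open>A ** U = U ** diag_matrix d\<close> is the eigenvector equation column by column;
  orthogonality of \<open>U\<close> then isolates \<open>A\<close>.\<close>

lemma symmetric_matrix_spectral_decomp:
  fixes A :: "real ^ 'n ^ 'n"
  assumes sym: "transpose A = A"
  obtains U d where "spectral_decomp A U d"
proof -
  obtain B where B: "pairwise orthogonal B" "\<And>b. b \<in> B \<Longrightarrow> norm b = 1"
    "\<And>b. b \<in> B \<Longrightarrow> \<exists>\<mu>. A *v b = \<mu> *\<^sub>R b" "card B = CARD('n)"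
    using symmetric_matrix_orthonormal_eigenbasis[OF sym] by blast
  have "finite B" using B(4) by (metis card_ge_0_finite zero_less_card_finite)
  with B(4) obtain h :: "'n \<Rightarrow> real ^ 'n" where h: "bij_betw h UNIV B"
    using finite_same_card_bij[of "UNIV :: 'n set" B] by auto
  obtain m where m: "\<And>b. b \<in> B \<Longrightarrow> A *v b = m b *\<^sub>R b" using B(3) by metis
  define U :: "real ^ 'n ^ 'n" where "U = (\<chi> i j. h j $ i)"
  define d :: "real ^ 'n" where "d = (\<chi> j. m (h j))"
  have col: "column j U = h j" for j by (simp add: U_def column_def vec_eq_iff)
  have hB: "h j \<in> B" for j using h by (auto simp: bij_betw_def)
  have U: "orthogonal_matrix U"
    unfolding orthogonal_matrix_orthonormal_columns col
    using B(2) hB pairwiseD[OF B(1) hB hB] bij_betw_imp_inj_on[OF h] by (simp add: inj_eq)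
  have "A ** U = U ** diag_matrix d"
  proof -
    have "(A ** U) $ i $ j = (U ** diag_matrix d) $ i $ j" for i j
    proof -
      have "(A ** U) $ i $ j = (A *v h j) $ i"
        by (simp add: matrix_matrix_mult_def matrix_vector_mult_def U_def)
      also have "\<dots> = (U ** diag_matrix d) $ i $ j"
        by (simp add: m[OF hB] diag_matrix_mult_right U_def d_def)
      finally show ?thesis .
    qed
    then show ?thesis by (simp add: vec_eq_iff)
  qed
  then have "A = U ** diag_matrix d ** transpose U"
    using U by (metis matrix_mul_assoc matrix_mul_rid orthogonal_matrix_def)
  with U that show ?thesis by (auto simp: spectral_decomp_def)
qed

section \<open>Eigenvalues and norm estimates for matrix functions\<close>

lemma spectral_decomp_eigenvalue:
  assumes "spectral_decomp A U d"
  shows "matrix_eigenvalue A (d $ j)"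
proof -
  have U: "orthogonal_matrix U" and A: "A = U ** diag_matrix d ** transpose U"
    using assms by (auto simp: spectral_decomp_def)
  have "A ** U = U ** diag_matrix d"
    using U A by (metis matrix_mul_assoc matrix_mul_rid orthogonal_matrix_def)
  then have "(A ** U) $ i $ j = d $ j * U $ i $ j" for i
    by (simp add: diag_matrix_mult_right)
  then have "A *v column j U = d $ j *\<^sub>R column j U"
    by (simp add: vec_eq_iff column_def matrix_matrix_mult_def matrix_vector_mult_def)
  moreover have "column j U \<noteq> 0"
    using U by (metis norm_zero orthogonal_matrix_orthonormal_columns zero_neq_one)
  ultimately show ?thesis by (auto simp: matrix_eigenvalue_def)
qed

lemma psd_matrix_eigenvalue_nonneg:
  assumes "psd_matrix A" "matrix_eigenvalue A \<mu>"
  shows "0 \<le> \<mu>"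
proof -
  obtain v where v: "v \<noteq> 0" "A *v v = \<mu> *\<^sub>R v"
    using assms(2) by (auto simp: matrix_eigenvalue_def)
  then have "0 \<le> \<mu> * (v \<bullet> v)"
    using assms(1) by (metis inner_scaleR_right psd_matrix_def)
  moreover have "0 < v \<bullet> v" using v by simp
  ultimately show ?thesis by (simp add: zero_le_mult_iff)
qed

lemma norm_orthogonal_matrix:
  fixes U :: "real ^ 'n ^ 'n"
  assumes "orthogonal_matrix U"
  shows "norm (U *v x) = norm x"
  using assms orthogonal_transformation_matrix[of "(*v) U"]
  by (simp add: orthogonal_transformation_norm)

lemma norm_diag_matrix_mono:
  assumes "\<And>i. \<bar>a $ i\<bar> \<le> \<bar>b $ i\<bar>"
  shows "norm (diag_matrix a *v y) \<le> norm (diag_matrix b *v y)"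
proof -
  have "(diag_matrix a *v y) $ i = a $ i * y $ i" for a i
    by (simp add: diag_matrix_def matrix_vector_mult_def if_distrib[of "\<lambda>x. x * _"] sum.delta'
        cong: if_cong)
  then show ?thesis
    using assms by (intro norm_le_componentwise_cart) (simp add: abs_mult mult_right_mono)
qed

lemma matrix_fun_diff:
  assumes "spectral_decomp A U d"
  shows "matrix_fun f A *v x - matrix_fun g A *v x = matrix_fun (\<lambda>t. f t - g t) A *v x"
proof -
  have "diag_matrix (\<chi> i. f (d $ i) - g (d $ i)) =
        diag_matrix (\<chi> i. f (d $ i)) - diag_matrix (\<chi> i. g (d $ i))"
    by (simp add: diag_matrix_def vec_eq_iff)
  then show ?thesis
    by (simp add: matrix_fun_eq[OF assms] matrix_vector_mult_diff_rdistrib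
        matrix_vector_mult_diff_distrib flip: matrix_vector_mul_assoc)
qed

text \<open>The orthogonal factors preserve the norm, so only the values of \<open>f\<close> and
  \<open>g\<close> at the eigenvalues matter. With one of them constant this serves for upper as
  well as lower bounds.\<close>

lemma norm_matrix_fun_mono:
  assumes "spectral_decomp A U d" "\<And>i. \<bar>f (d $ i)\<bar> \<le> \<bar>g (d $ i)\<bar>"
  shows "norm (matrix_fun f A *v x) \<le> norm (matrix_fun g A *v x)"
proof -
  have U: "orthogonal_matrix U" using assms by (auto simp: spectral_decomp_def)
  show ?thesis
    using assms(2)
    by (simp add: matrix_fun_eq[OF assms(1)] norm_orthogonal_matrix[OF U] norm_diag_matrix_mono
        del: transpose_matrix_vector flip: matrix_vector_mul_assoc)
qed

lemma norm_matrix_fun_const: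
  fixes A :: "real ^ 'n ^ 'n"
  assumes "spectral_decomp A U d"
  shows "norm (matrix_fun (\<lambda>t. c) A *v x) = \<bar>c\<bar> * norm x"
proof -
  have "orthogonal_matrix U" "orthogonal_matrix (transpose U)"
    using assms by (auto simp: spectral_decomp_def)
  moreover have "diag_matrix (\<chi> i. c) *v y = c *\<^sub>R y" for y :: "real ^ 'n"
    by (simp add: vec_eq_iff diag_matrix_def matrix_vector_mult_def if_distrib[of "\<lambda>x. x * _"]
        sum.delta' cong: if_cong)
  ultimately show ?thesis
    by (simp add: matrix_fun_eq[OF assms] norm_orthogonal_matrix matrix_vector_mult_scaleR
        del: transpose_matrix_vector flip: matrix_vector_mul_assoc)
qed


section \<open>Chebyshev expansion of the exponential\<close>

text \<open>\<open>bessel a k\<close> is the modified Bessel function value \<open>I\<^sub>k(2a)\<close>.\<close>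

definition bessel_term :: "real \<Rightarrow> nat \<Rightarrow> nat \<Rightarrow> real" where
  "bessel_term a k m = a ^ (2 * m + k) / (fact m * fact (m + k))"

definition bessel :: "real \<Rightarrow> nat \<Rightarrow> real" where
  "bessel a k = (\<Sum>m. bessel_term a k m)"

text \<open>Each of the \<open>m\<close> factors that lead from \<open>fact k\<close> to
  \<open>fact (m + k)\<close> is at least \<open>k + 1\<close>.\<close>

lemma fact_mult_power_le_fact_add:
  "fact k * (real k + 1) ^ m \<le> fact (m + k)"
proof (induction m)
  case (Suc m)
  have "fact k * (real k + 1) ^ Suc m = (real k + 1) * (fact k * (real k + 1) ^ m)"
    by simp
  also have "\<dots> \<le> (real k + 1) * fact (m + k)"
    using Suc by (intro mult_left_mono) auto
  also have "\<dots> \<le> (1 + (real m + real k)) * fact (m + k)"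
    by (intro mult_right_mono) auto
  finally show ?case by simp
qed simp

lemma exp_sums_real: "(\<lambda>m. (x::real) ^ m / fact m) sums exp x"
  using exp_converges[of x] by (simp add: field_simps)

text \<open>Bounding \<open>fact (m + k)\<close> by \<open>fact_mult_power_le_fact_add\<close>
  leaves the terms of an exponential series in \<open>a\<^sup>2 / (real k + 1)\<close>.\<close>

lemma abs_bessel_term_le:
  "\<bar>bessel_term a k m\<bar> \<le> \<bar>a\<bar> ^ k / fact k * ((a\<^sup>2 / (real k + 1)) ^ m / fact m)"
proof -
  have "\<bar>bessel_term a k m\<bar> = \<bar>a\<bar> ^ k * (a\<^sup>2) ^ m / (fact m * fact (m + k))"
    by (simp add: bessel_term_def abs_mult power_add power_mult power_abs)
  also have "\<dots> \<le> \<bar>a\<bar> ^ k * (a\<^sup>2) ^ m / (fact m * (fact k * (real k + 1) ^ m))"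
    using fact_mult_power_le_fact_add[of k m]
    by (intro divide_left_mono mult_left_mono mult_pos_pos) auto
  also have "\<dots> = \<bar>a\<bar> ^ k / fact k * ((a\<^sup>2 / (real k + 1)) ^ m / fact m)"
    by (simp add: power_divide)
  finally show ?thesis .
qed

lemma summable_norm_bessel_term: "summable (\<lambda>m. norm (bessel_term a k m))"
proof (rule summable_comparison_test)
  show "\<exists>N. \<forall>m\<ge>N. norm (norm (bessel_term a k m)) \<le>
          \<bar>a\<bar> ^ k / fact k * ((a\<^sup>2 / (real k + 1)) ^ m / fact m)"
    using abs_bessel_term_le by auto
  show "summable (\<lambda>m. \<bar>a\<bar> ^ k / fact k * ((a\<^sup>2 / (real k + 1)) ^ m / fact m))"
    using exp_sums_real by (intro summable_mult) (auto simp: sums_iff)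
qed

lemma bessel_has_sum: "(bessel_term a k has_sum bessel a k) UNIV"
  unfolding bessel_def
  by (intro norm_summable_imp_has_sum summable_sums summable_norm_bessel_term
      summable_norm_cancel[OF summable_norm_bessel_term])

lemma abs_bessel_le: "\<bar>bessel a k\<bar> \<le> \<bar>a\<bar> ^ k / fact k * exp (a\<^sup>2 / (real k + 1))"
proof -
  have "\<bar>bessel a k\<bar> \<le> (\<Sum>m. \<bar>bessel_term a k m\<bar>)"
    unfolding bessel_def using summable_norm[OF summable_norm_bessel_term[of a k]] by simp
  also have "\<dots> \<le> (\<Sum>m. \<bar>a\<bar> ^ k / fact k * ((a\<^sup>2 / (real k + 1)) ^ m / fact m))"
    using summable_norm_bessel_term[of a k] exp_sums_real abs_bessel_term_le
    by (intro suminf_le summable_mult) (auto simp: sums_iff)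
  also have "\<dots> = \<bar>a\<bar> ^ k / fact k * exp (a\<^sup>2 / (real k + 1))"
    using exp_sums_real[of "a\<^sup>2 / (real k + 1)"] by (subst suminf_mult) (auto simp: sums_iff)
  finally show ?thesis .
qed

section \<open>Jacobi-Anger expansion\<close>

lemma exp_has_sum: "((\<lambda>n. z ^ n /\<^sub>R fact n) has_sum exp z) UNIV"
  for z :: "'a :: {real_normed_field, banach}"
  by (intro norm_summable_imp_has_sum summable_norm_exp exp_converges)

text \<open>Unordered summation over pairs, so that the terms may later be regrouped by
  \<open>p - q\<close>. Iterated sums give the value, and absolute summability makes it the sum over
  all pairs.\<close>

lemma exp_mult_exp_has_sum:
  fixes z w :: complex
  shows "((\<lambda>(p, q). (z ^ p /\<^sub>R fact p) * (w ^ q /\<^sub>R fact q)) has_sum exp z * exp w) (UNIV \<times> UNIV)"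
proof (rule has_sum_SigmaI[where g = "\<lambda>p. (z ^ p /\<^sub>R fact p) * exp w"])
  fix p
  show "((\<lambda>q. case (p, q) of (p, q) \<Rightarrow> (z ^ p /\<^sub>R fact p) * (w ^ q /\<^sub>R fact q)) has_sum
      (z ^ p /\<^sub>R fact p) * exp w) UNIV"
    unfolding prod.case by (intro has_sum_cmult_right exp_has_sum)
next
  show "((\<lambda>p. (z ^ p /\<^sub>R fact p) * exp w) has_sum exp z * exp w) UNIV"
    by (intro has_sum_cmult_left exp_has_sum)
next
  \<comment> \<open>The norms form the product of the real exponential series at
    \<open>norm z\<close> and \<open>norm w\<close>.\<close>
  have nn: "((\<lambda>n. norm (z ^ n /\<^sub>R fact n)) has_sum exp (norm z)) UNIV" for z :: complex
    using exp_has_sum[of "norm z"] by (simp add: norm_power norm_divide)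
  have "(\<lambda>x. norm (case x of (p, q) \<Rightarrow> (z ^ p /\<^sub>R fact p) * (w ^ q /\<^sub>R fact q)))
          summable_on UNIV \<times> UNIV"
  proof (rule summable_on_SigmaI[where g = "\<lambda>p. norm (z ^ p /\<^sub>R fact p) * exp (norm w)"])
    show "((\<lambda>q. norm (case (p, q) of (p, q) \<Rightarrow> (z ^ p /\<^sub>R fact p) * (w ^ q /\<^sub>R fact q)))
        has_sum norm (z ^ p /\<^sub>R fact p) * exp (norm w)) UNIV" for p
      unfolding prod.case norm_mult by (intro has_sum_cmult_right nn)
    show "(\<lambda>p. norm (z ^ p /\<^sub>R fact p) * exp (norm w)) summable_on UNIV"
      using nn by (intro summable_on_cmult_left) (auto simp: summable_on_def)
  qed auto
  then show "(\<lambda>(p, q). (z ^ p /\<^sub>R fact p) * (w ^ q /\<^sub>R fact q)) summable_on UNIV \<times> UNIV"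
    by (rule abs_summable_summable)
qed

text \<open>The exponents \<open>a * cis \<theta>\<close> and \<open>a * cis (- \<theta>)\<close>
  add up to the real number \<open>2 * a * cos \<theta>\<close>; by De Moivre the
  \<open>(p, q)\<close> term of the product has angle \<open>(p - q) * \<theta>\<close>, and its
  real part is kept.\<close>

lemma exp_cos_has_sum:
  "((\<lambda>(p, q). a ^ (p + q) / (fact p * fact q) * cos ((real p - real q) * \<theta>)) has_sum
     exp (2 * a * cos \<theta>)) (UNIV \<times> UNIV)"
proof -
  have 1: "exp (complex_of_real a * cis \<theta>) * exp (complex_of_real a * cis (- \<theta>)) =
        of_real (exp (2 * a * cos \<theta>))"
  proof -
    have "complex_of_real a * cis \<theta> + complex_of_real a * cis (- \<theta>) = of_real (2 * a * cos \<theta>)"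
      by (simp add: complex_eq_iff)
    then show ?thesis by (metis exp_add exp_of_real)
  qed
  have 2: "Re (((of_real a * cis \<theta>) ^ p /\<^sub>R fact p) * ((of_real a * cis (- \<theta>)) ^ q /\<^sub>R fact q)) =
     a ^ (p + q) / (fact p * fact q) * cos ((real p - real q) * \<theta>)" for p q
  proof -
    have "((of_real a * cis \<theta>) ^ p /\<^sub>R fact p) * ((of_real a * cis (- \<theta>)) ^ q /\<^sub>R fact q) =
       of_real (a ^ (p + q) / (fact p * fact q)) * (cis (real p * \<theta>) * cis (real q * (- \<theta>)))"
      by (simp add: power_mult_distrib Complex.DeMoivre scaleR_conv_of_real power_add divide_simps)
    also have "cis (real p * \<theta>) * cis (real q * (- \<theta>)) = cis ((real p - real q) * \<theta>)"
      by (simp add: cis_mult algebra_simps)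
    finally show ?thesis
      by (simp only: times_complex.sel Re_complex_of_real Im_complex_of_real cis.sel mult_zero_left
          diff_zero)
  qed
  show ?thesis
    using has_sum_Re[OF exp_mult_exp_has_sum[of "of_real a * cis \<theta>" "of_real a * cis (- \<theta>)"]]
    unfolding 1 case_prod_beta 2 by simp
qed

text \<open>The terms of the double series \<open>exp_cos_has_sum\<close> are grouped by \<open>k = \<bar>p - q\<bar>\<close>, separately for
  \<open>q \<le> p\<close> and for \<open>p < q\<close>.\<close>

lemma exp_cos_sums:
  "(\<lambda>k. (if k = 0 then 1 else 2) * bessel a k * cos (real k * \<theta>)) sums exp (2 * a * cos \<theta>)"
proof -
  define F where "F = (\<lambda>(p, q). a ^ (p + q) / (fact p * fact q) * cos ((real p - real q) * \<theta>))"
  have F: "(F has_sum exp (2 * a * cos \<theta>)) UNIV"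
    using exp_cos_has_sum[of a \<theta>] unfolding F_def by simp
  \<comment> \<open>Summability passes to subsets, so both halves have sums; only
    \<open>s1 + s2\<close> needs to be known.\<close>
  have "F summable_on S" for S
    using F by (meson subset_UNIV summable_on_def summable_on_subset_banach)
  then obtain s1 s2 where s1: "(F has_sum s1) {(p, q). q \<le> p}" and s2: "(F has_sum s2) {(p, q). p < q}"
    unfolding summable_on_def by blast
  have "(F has_sum (s1 + s2)) ({(p, q). q \<le> p} \<union> {(p, q). p < q})"
    by (intro has_sum_Un_disjoint s1 s2) auto
  also have "{(p, q). q \<le> p} \<union> {(p, q). p < q} = (UNIV :: (nat \<times> nat) set)"
    by auto
  finally have eq: "s1 + s2 = exp (2 * a * cos \<theta>)"
    using F has_sum_unique by blast
  \<comment> \<open>Here \<open>q = m\<close> and \<open>p = m + k\<close>; summing over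
    \<open>m\<close> for fixed \<open>k\<close> yields \<open>bessel a k\<close>.\<close>
  have "((\<lambda>(k, m). bessel_term a k m * cos (real k * \<theta>)) has_sum s1) (UNIV \<times> UNIV)
        \<longleftrightarrow> (F has_sum s1) {(p, q). q \<le> p}"
    by (rule has_sum_reindex_bij_witness[where j = "\<lambda>(k, m). (m + k, m)" and i = "\<lambda>(p, q). (p - q, q)"])
       (auto simp: F_def bessel_term_def mult_2 add_ac)
  with s1 have "((\<lambda>(k, m). bessel_term a k m * cos (real k * \<theta>)) has_sum s1) (UNIV \<times> UNIV)"
    by simp
  then have "((\<lambda>k. bessel a k * cos (real k * \<theta>)) has_sum s1) UNIV"
    by (rule has_sum_SigmaD) (simp add: has_sum_cmult_left bessel_has_sum)
  then have 1: "(\<lambda>k. bessel a k * cos (real k * \<theta>)) sums s1"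
    by (rule has_sum_imp_sums)
  \<comment> \<open>The diagonal \<open>p = q\<close> already belongs to \<open>s1\<close>, so the
    offset \<open>q - p\<close> starts at 1, hence \<open>Suc k\<close>.\<close>
  have "((\<lambda>(k, m). bessel_term a (Suc k) m * cos (real (Suc k) * \<theta>)) has_sum s2) (UNIV \<times> UNIV)
        \<longleftrightarrow> (F has_sum s2) {(p, q). p < q}"
  proof (rule has_sum_reindex_bij_witness[where j = "\<lambda>(k, m). (m, m + Suc k)" and i = "\<lambda>(p, q). (q - Suc p, p)"])
    fix km :: "nat \<times> nat"
    obtain k m where km: "km = (k, m)" by force
    have "cos ((real m - real (m + Suc k)) * \<theta>) = cos (real (Suc k) * \<theta>)"
      using cos_minus[of "real (Suc k) * \<theta>"] by (simp add: algebra_simps)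
    then show "F (case km of (k, m) \<Rightarrow> (m, m + Suc k)) =
        (case km of (k, m) \<Rightarrow> bessel_term a (Suc k) m * cos (real (Suc k) * \<theta>))"
      by (simp add: km F_def bessel_term_def mult_2 add_ac del: of_nat_Suc fact_Suc)
  qed auto
  with s2 have "((\<lambda>(k, m). bessel_term a (Suc k) m * cos (real (Suc k) * \<theta>)) has_sum s2) (UNIV \<times> UNIV)"
    by simp
  then have "((\<lambda>k. bessel a (Suc k) * cos (real (Suc k) * \<theta>)) has_sum s2) UNIV"
    by (rule has_sum_SigmaD) (simp add: has_sum_cmult_left bessel_has_sum del: of_nat_Suc)
  then have "(\<lambda>k. bessel a (Suc k) * cos (real (Suc k) * \<theta>)) sums s2"
    by (rule has_sum_imp_sums)
  \<comment> \<open>With 0 at index 0, adding \<open>s2\<close> doubles every term of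
    \<open>s1\<close> except the first; this is the origin of the weights 1 and 2.\<close>
  then have 2: "(\<lambda>k. if k = 0 then 0 else bessel a k * cos (real k * \<theta>)) sums s2"
    using sums_Suc[of "\<lambda>k. if k = 0 then 0 else bessel a k * cos (real k * \<theta>)" s2] by simp
  show ?thesis
    using sums_add[OF 1 2] unfolding eq by (rule sums_cong[THEN iffD1, rotated]) auto
qed

section \<open>Fourier cosine coefficients by termwise integration\<close>

lemma summable_bessel: "summable (\<lambda>k. 2 * \<bar>bessel a k\<bar>)"
proof (rule summable_comparison_test)
  \<comment> \<open>Replacing \<open>a\<^sup>2 / (real k + 1)\<close> by \<open>a\<^sup>2\<close>
    makes the exponential factor independent of \<open>k\<close>.\<close>
  have "\<bar>bessel a k\<bar> \<le> \<bar>a\<bar> ^ k / fact k * exp (a\<^sup>2)" for k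
    by (rule order_trans[OF abs_bessel_le mult_left_mono])
       (auto simp: divide_le_eq mult_le_cancel_left1 power2_less_0)
  then show "\<exists>N. \<forall>k\<ge>N. norm (2 * \<bar>bessel a k\<bar>) \<le> 2 * (\<bar>a\<bar> ^ k / fact k * exp (a\<^sup>2))"
    by (intro exI allI impI) (simp only: real_norm_def abs_mult abs_abs abs_numeral mult_le_cancel_left_pos
        zero_less_numeral)
  show "summable (\<lambda>k. 2 * (\<bar>a\<bar> ^ k / fact k * exp (a\<^sup>2)))"
    using exp_sums_real by (intro summable_mult summable_mult2) (auto simp: sums_iff)
qed

lemma has_integral_cos_nat_mult:
  "((\<lambda>\<theta>. cos (real n * \<theta>)) has_integral (if n = 0 then pi else 0)) {0..pi}"
proof (cases "n = 0")
  case True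
  then show ?thesis using has_integral_const_real[of "1::real" 0 pi] by simp
next
  case False
  have "((\<lambda>\<theta>. cos (real n * \<theta>)) has_integral
          (sin (real n * pi) / real n - sin (real n * 0) / real n)) {0..pi}"
    using False
    by (intro fundamental_theorem_of_calculus)
       (auto intro!: derivative_eq_intros simp flip: has_real_derivative_iff_has_vector_derivative)
  with False show ?thesis by simp
qed

lemma has_integral_cos_mult_cos:
  "((\<lambda>\<theta>. cos (real j * \<theta>) * cos (real k * \<theta>)) has_integral
     (if j = k then if k = 0 then pi else pi / 2 else 0)) {0..pi}"
proof -
  \<comment> \<open>Product-to-sum formula; evenness of the cosine permits the natural frequency
    \<open>nat \<bar>int j - int k\<bar>\<close>.\<close>
  have eq: "cos (real j * \<theta>) * cos (real k * \<theta>) =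
      (cos (real (nat \<bar>int j - int k\<bar>) * \<theta>) + cos (real (j + k) * \<theta>)) / 2" for \<theta>
  proof -
    have "cos (real (nat \<bar>int j - int k\<bar>) * \<theta>) = cos (real j * \<theta> - real k * \<theta>)"
    proof (cases "j \<le> k")
      case True
      then have "real (nat \<bar>int j - int k\<bar>) * \<theta> = - (real j * \<theta> - real k * \<theta>)"
        by (simp add: algebra_simps)
      then show ?thesis by (metis cos_minus)
    qed (simp add: algebra_simps)
    then show ?thesis
      by (simp add: cos_times_cos distrib_right)
  qed
  \<comment> \<open>Both frequencies vanish if \<open>j = k = 0\<close>, only the first if
    \<open>j = k > 0\<close>: hence \<open>pi\<close> and \<open>pi / 2\<close>.\<close>
  have "((\<lambda>\<theta>. (cos (real (nat \<bar>int j - int k\<bar>) * \<theta>) + cos (real (j + k) * \<theta>)) / 2) has_integral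
      ((if nat \<bar>int j - int k\<bar> = 0 then pi else 0) + (if j + k = 0 then pi else 0)) / 2) {0..pi}"
    by (intro has_integral_divide has_integral_add has_integral_cos_nat_mult)
  then show ?thesis
    unfolding eq by (rule has_integral_eq_rhs) auto
qed

text \<open>Absolute summability of \<open>b\<close> gives uniform convergence by the Weierstrass
  test, so sum and integral commute; orthogonality of the cosines then picks out the term
  \<open>j = k\<close>.\<close>

lemma cos_series_integral:
  assumes sums: "\<And>\<theta>. (\<lambda>j. b j * cos (real j * \<theta>)) sums f \<theta>" and "summable (\<lambda>j. \<bar>b j\<bar>)"
  shows "((\<lambda>\<theta>. cos (real k * \<theta>) * f \<theta>) has_integral b k * (if k = 0 then pi else pi / 2)) {0..pi}"
proof -
  let ?g = "\<lambda>j \<theta>. b j * (cos (real j * \<theta>) * cos (real k * \<theta>))"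
  have "uniform_limit {0..pi} (\<lambda>n \<theta>. \<Sum>j<n. ?g j \<theta>) (\<lambda>\<theta>. suminf (\<lambda>j. ?g j \<theta>)) sequentially"
  proof (rule Weierstrass_m_test)
    show "norm (?g j \<theta>) \<le> \<bar>b j\<bar>" for j \<theta>
      using mult_mono[OF abs_cos_le_one[of "real j * \<theta>"] abs_cos_le_one[of "real k * \<theta>"]]
      by (simp add: abs_mult mult_left_le)
  qed fact
  moreover have "suminf (\<lambda>j. ?g j \<theta>) = cos (real k * \<theta>) * f \<theta>" for \<theta>
    using sums_mult[OF sums[of \<theta>], of "cos (real k * \<theta>)"] by (simp add: sums_iff mult_ac)
  ultimately have lim:
    "uniform_limit {0..pi} (\<lambda>n \<theta>. \<Sum>j<n. ?g j \<theta>) (\<lambda>\<theta>. cos (real k * \<theta>) * f \<theta>) sequentially"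
    by simp
  obtain I J where I: "\<And>n. ((\<lambda>\<theta>. \<Sum>j<n. ?g j \<theta>) has_integral I n) {0..pi}"
    and J: "((\<lambda>\<theta>. cos (real k * \<theta>) * f \<theta>) has_integral J) {0..pi}" and IJ: "I \<longlonglongrightarrow> J"
    by (rule uniform_limit_integral[OF lim]) (auto intro!: continuous_intros)
  \<comment> \<open>Once the partial sum contains the index \<open>k\<close>, its integral no longer
    changes.\<close>
  have "I n = b k * (if k = 0 then pi else pi / 2)" if "n > k" for n
  proof -
    have "((\<lambda>\<theta>. \<Sum>j<n. ?g j \<theta>) has_integral
        (\<Sum>j<n. b j * (if j = k then if k = 0 then pi else pi / 2 else 0))) {0..pi}"
      by (intro has_integral_sum has_integral_mult_right has_integral_cos_mult_cos) auto
    then have "I n = (\<Sum>j<n. b j * (if j = k then if k = 0 then pi else pi / 2 else 0))"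
      using I has_integral_unique by blast
    also have "\<dots> = (\<Sum>j<n. if j = k then b k * (if k = 0 then pi else pi / 2) else 0)"
      by (intro sum.cong) auto
    also have "\<dots> = b k * (if k = 0 then pi else pi / 2)"
      using that by (simp add: sum.delta)
    finally show ?thesis .
  qed
  then have "I \<longlonglongrightarrow> b k * (if k = 0 then pi else pi / 2)"
    by (intro tendsto_eventually eventually_sequentiallyI[of "Suc k"]) auto
  with J IJ LIMSEQ_unique show ?thesis by blast
qed

lemma cheb_coeff_eq: "cheb_coeff \<tau> k = 2 * exp (- \<tau>) * bessel (- \<tau> / 2) k"
proof -
  let ?b = "\<lambda>k. (if k = 0 then 1 else 2) * bessel (- \<tau> / 2) k"
  have "((\<lambda>\<theta>. cos (real k * \<theta>) * exp (2 * (- \<tau> / 2) * cos \<theta>)) has_integral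
      ?b k * (if k = 0 then pi else pi / 2)) {0..pi}"
  proof (rule cos_series_integral)
    show "(\<lambda>j. ?b j * cos (real j * \<theta>)) sums exp (2 * (- \<tau> / 2) * cos \<theta>)" for \<theta>
      by (rule exp_cos_sums)
    show "summable (\<lambda>j. \<bar>?b j\<bar>)"
      by (rule summable_comparison_test[OF _ summable_bessel[of "- \<tau> / 2"]]) (auto simp: abs_mult)
  qed
  \<comment> \<open>The weights 1 and 2 balance \<open>pi\<close> and \<open>pi / 2\<close>, so one
    formula covers \<open>k = 0\<close> as well.\<close>
  then have "((\<lambda>\<theta>. exp (- \<tau>) * (cos (real k * \<theta>) * exp (2 * (- \<tau> / 2) * cos \<theta>))) has_integral
      exp (- \<tau>) * (pi * bessel (- \<tau> / 2) k)) {0..pi}"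
    by (intro has_integral_mult_right) (auto simp: mult_ac split: if_splits)
  moreover have "exp (- \<tau>) * (cos (real k * \<theta>) * exp (2 * (- \<tau> / 2) * cos \<theta>)) =
      cos (real k * \<theta>) * exp (- \<tau> * (cos \<theta> + 1))" for \<theta>
    by (simp add: algebra_simps flip: exp_add)
  ultimately have "integral {0..pi} (\<lambda>\<theta>. cos (real k * \<theta>) * exp (- \<tau> * (cos \<theta> + 1))) =
      exp (- \<tau>) * (pi * bessel (- \<tau> / 2) k)"
    by (simp only: integral_unique)
  then show ?thesis by (simp add: cheb_coeff_def)
qed

section \<open>Remainder of the truncated expansion\<close>

lemma cheb_trunc_error_sums:
  "(\<lambda>j. 2 * exp (- \<tau>) * bessel (- \<tau> / 2) (j + Suc K) * cos (real (j + Suc K) * \<theta>)) sums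
     (exp (- \<tau> * (cos \<theta> + 1)) - poly (cheb_trunc K \<tau>) (cos \<theta> + 1))"
proof -
  let ?c = "\<lambda>k. exp (- \<tau>) * ((if k = 0 then 1 else 2) * bessel (- \<tau> / 2) k * cos (real k * \<theta>))"
  have "?c sums (exp (- \<tau>) * exp (2 * (- \<tau> / 2) * cos \<theta>))"
    by (intro sums_mult exp_cos_sums)
  also have "exp (- \<tau>) * exp (2 * (- \<tau> / 2) * cos \<theta>) = exp (- \<tau> * (cos \<theta> + 1))"
    by (simp add: algebra_simps flip: exp_add)
  finally have "(\<lambda>j. ?c (j + Suc K)) sums (exp (- \<tau> * (cos \<theta> + 1)) - (\<Sum>k<Suc K. ?c k))"
    by (rule sums_split_initial_segment)
  \<comment> \<open>Halving the coefficient of index 0 in \<open>cheb_trunc\<close> matches the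
    weight 1 there, so the first \<open>Suc K\<close> terms are exactly the truncation.\<close>
  moreover have "(\<Sum>k<Suc K. ?c k) = poly (cheb_trunc K \<tau>) (cos \<theta> + 1)"
  proof -
    have "(\<Sum>k<Suc K. ?c k) = ?c 0 + (\<Sum>k=1..K. ?c k)"
      by (simp add: sum.lessThan_Suc_shift sum.atLeast1_atMost_eq del: sum.lessThan_Suc)
    also have "(\<Sum>k=1..K. ?c k) = (\<Sum>k=1..K. cheb_coeff \<tau> k * poly (cheb_poly k) (cos \<theta>))"
      by (intro sum.cong) (auto simp: cheb_coeff_eq poly_cheb_poly_cos)
    finally show ?thesis
      by (simp add: poly_cheb_trunc cheb_coeff_eq)
  qed
  ultimately show ?thesis by (simp add: mult_ac)
qed

text \<open>The growth from \<open>fact (Suc K)\<close> to \<open>fact (j + Suc K)\<close> supplies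
  the geometric factor; the exponential factor is largest at \<open>j = 0\<close>, where its
  denominator is \<open>K + 2\<close>.\<close>

lemma abs_bessel_tail_le:
  assumes "0 \<le> s"
  shows "\<bar>bessel (- s) (j + Suc K)\<bar> \<le>
    exp (s\<^sup>2 / (real K + 2)) * (s ^ Suc K / fact (Suc K)) * (s / real (Suc K)) ^ j"
proof -
  \<comment> \<open>The new factors are even at least \<open>K + 2\<close>; the weaker
    \<open>Suc K\<close> gives the ratio \<open>s / real (Suc K)\<close> that leads to the
    denominator in \<open>cheb_err\<close>.\<close>
  have "fact (Suc K) * real (Suc K) ^ j \<le> fact (Suc K) * (real (Suc K) + 1) ^ j"
    by (intro mult_left_mono power_mono) auto
  also have "\<dots> \<le> fact (j + Suc K)"
    by (rule fact_mult_power_le_fact_add)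
  finally have f: "fact (Suc K) * real (Suc K) ^ j \<le> fact (j + Suc K)" .
  have "\<bar>bessel (- s) (j + Suc K)\<bar> \<le>
      s ^ (j + Suc K) / fact (j + Suc K) * exp (s\<^sup>2 / (real (j + Suc K) + 1))"
    using abs_bessel_le[of "- s" "j + Suc K"] assms by simp
  also have "\<dots> \<le> s ^ (j + Suc K) / (fact (Suc K) * real (Suc K) ^ j) * exp (s\<^sup>2 / (real K + 2))"
    using assms f
    by (intro mult_mono divide_left_mono) (auto intro!: divide_left_mono mult_pos_pos)
  also have "\<dots> = exp (s\<^sup>2 / (real K + 2)) * (s ^ Suc K / fact (Suc K)) * (s / real (Suc K)) ^ j"
    by (simp add: power_add power_divide del: fact_Suc of_nat_Suc)
  finally show ?thesis .
qed

lemma cheb_trunc_error_le: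
  assumes "0 \<le> \<tau>" "real K > \<tau> / 2 - 1" "t \<in> {0..2}"
  shows "\<bar>exp (- \<tau> * t) - poly (cheb_trunc K \<tau>) t\<bar> \<le> cheb_err K \<tau>"
proof -
  define s \<theta> where "s = \<tau> / 2" and "\<theta> = arccos (t - 1)"
  define r E where "r = s / real (Suc K)"
    and "E = 2 * exp (- \<tau>) * (exp (s\<^sup>2 / (real K + 2)) * (s ^ Suc K / fact (Suc K)))"
  have s: "0 \<le> s" "s < real K + 1" using assms by (auto simp: s_def)
  \<comment> \<open>The hypothesis on \<open>K\<close> says exactly that the ratio \<open>r\<close>
    is below 1.\<close>
  then have r: "0 \<le> r" "r < 1" by (auto simp: r_def)
  have t: "cos \<theta> + 1 = t" using assms(3) by (simp add: \<theta>_def cos_arccos)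
  let ?h = "\<lambda>j. 2 * exp (- \<tau>) * bessel (- \<tau> / 2) (j + Suc K) * cos (real (j + Suc K) * \<theta>)"
  have sums: "?h sums (exp (- \<tau> * t) - poly (cheb_trunc K \<tau>) t)"
    using cheb_trunc_error_sums[of \<tau> K \<theta>] unfolding t .
  have le: "norm (?h j) \<le> E * r ^ j" for j
  proof -
    have "norm (?h j) \<le> 2 * exp (- \<tau>) * \<bar>bessel (- s) (j + Suc K)\<bar>"
      by (simp add: abs_mult s_def mult_left_le del: of_nat_Suc of_nat_add)
    also have "\<dots> \<le> 2 * exp (- \<tau>) *
        (exp (s\<^sup>2 / (real K + 2)) * (s ^ Suc K / fact (Suc K)) * (s / real (Suc K)) ^ j)"
      by (intro mult_left_mono abs_bessel_tail_le s) auto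
    finally show ?thesis by (simp add: E_def r_def mult.assoc)
  qed
  have geo: "(\<lambda>j. E * r ^ j) sums (E * (1 / (1 - r)))"
    using r by (intro sums_mult geometric_sums) auto
  have "norm (\<Sum>j. ?h j) \<le> (\<Sum>j. E * r ^ j)"
    using geo by (intro norm_suminf_le le) (simp add: sums_iff)
  then have "\<bar>exp (- \<tau> * t) - poly (cheb_trunc K \<tau>) t\<bar> \<le> E * (1 / (1 - r))"
    using sums geo by (simp add: sums_iff)
  also have "\<dots> = cheb_err K \<tau>"
  proof -
    \<comment> \<open>The numerator \<open>real (Suc K)\<close> cancels in
      \<open>fact (Suc K)\<close>, which leaves \<open>fact K\<close> in
      \<open>cheb_err\<close>.\<close>
    have "1 / (1 - r) = real (Suc K) / (real K + 1 - s)"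
      using s by (simp add: r_def field_simps)
    then have "E * (1 / (1 - r)) = 2 * (exp (- \<tau>) * exp (s\<^sup>2 / (real K + 2))) *
        (s ^ Suc K / (fact K * (real K + 1 - s)))"
      by (simp add: E_def fact_Suc)
    also have "exp (- \<tau>) * exp (s\<^sup>2 / (real K + 2)) = exp (s\<^sup>2 / (real K + 2) - \<tau>)"
      by (simp flip: exp_add)
    finally show ?thesis by (simp add: cheb_err_def s_def)
  qed
  finally show ?thesis .
qed


section \<open>Error bounds\<close>

theorem mainTheorem3:
  fixes L :: "real ^ 'n ^ 'n" and \<tau> :: real and K :: nat and x :: "real ^ 'n"
  assumes "0 \<le> \<tau>"
    and "psd_matrix L"
    and "largest_eigenvalue L 2"
    and "real K > \<tau> / 2 - 1"
    and "x \<noteq> 0"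
  shows "(norm (matrix_fun (\<lambda>t. exp (- \<tau> * t)) L *v x - matrix_fun (poly (cheb_trunc K \<tau>)) L *v x))\<^sup>2
           / (norm x)\<^sup>2 \<le> (cheb_err K \<tau>)\<^sup>2
       \<and> (norm (matrix_fun (\<lambda>t. exp (- \<tau> * t)) L *v x - matrix_fun (poly (cheb_trunc K \<tau>)) L *v x))\<^sup>2
           / (norm (matrix_fun (\<lambda>t. exp (- \<tau> * t)) L *v x))\<^sup>2 \<le> (cheb_err K \<tau>)\<^sup>2 * exp (4 * \<tau>)"
proof -
  define e where "e = cheb_err K \<tau>"
  define E where "E = matrix_fun (\<lambda>t. exp (- \<tau> * t)) L *v x"
  define P where "P = matrix_fun (poly (cheb_trunc K \<tau>)) L *v x"
  obtain U d where sd: "spectral_decomp L U d"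
    using assms(2) symmetric_matrix_spectral_decomp by (auto simp: psd_matrix_def)
  \<comment> \<open>Semidefiniteness bounds the eigenvalues from below and the largest eigenvalue 2
    from above, so the scalar error bound holds at each of them.\<close>
  have d: "d $ i \<in> {0..2}" for i
    using spectral_decomp_eigenvalue[OF sd] psd_matrix_eigenvalue_nonneg[OF assms(2)] assms(3)
    by (auto simp: largest_eigenvalue_def)
  have err: "\<bar>exp (- \<tau> * t) - poly (cheb_trunc K \<tau>) t\<bar> \<le> e" if "t \<in> {0..2}" for t
    unfolding e_def using assms that by (intro cheb_trunc_error_le)
  have "0 \<le> e"
    using err[OF d] abs_ge_zero order_trans by blast
  have "norm (E - P) \<le> norm (matrix_fun (\<lambda>t. e) L *v x)"
    unfolding E_def P_def matrix_fun_diff[OF sd]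
    using err[OF d] \<open>0 \<le> e\<close> by (intro norm_matrix_fun_mono[OF sd]) simp
  also have "\<dots> = e * norm x"
    using \<open>0 \<le> e\<close> by (simp add: norm_matrix_fun_const[OF sd])
  finally have "(norm (E - P))\<^sup>2 \<le> (e * norm x)\<^sup>2"
    by (intro power_mono) auto
  then have upper: "(norm (E - P))\<^sup>2 \<le> e\<^sup>2 * (norm x)\<^sup>2"
    by (simp add: power_mult_distrib)
  \<comment> \<open>On \<open>{0..2}\<close> the function \<open>exp (- \<tau> * t)\<close> is least
    at \<open>t = 2\<close>; squaring this lower bound produces the factor
    \<open>exp (4 * \<tau>)\<close>.\<close>
  have "exp (- (2 * \<tau>)) * norm x = norm (matrix_fun (\<lambda>t. exp (- (2 * \<tau>))) L *v x)"
    by (simp add: norm_matrix_fun_const[OF sd])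
  also have "\<dots> \<le> norm E"
    unfolding E_def
  proof (rule norm_matrix_fun_mono[OF sd])
    show "\<bar>exp (- (2 * \<tau>))\<bar> \<le> \<bar>exp (- \<tau> * d $ i)\<bar>" for i
      using mult_left_mono[of "d $ i" 2 \<tau>] d[of i] assms(1) by (simp add: mult.commute)
  qed
  finally have "(exp (- (2 * \<tau>)) * norm x)\<^sup>2 \<le> (norm E)\<^sup>2"
    by (intro power_mono) auto
  moreover have "(exp (- (2 * \<tau>)) * norm x)\<^sup>2 = exp (- (4 * \<tau>)) * (norm x)\<^sup>2"
    by (simp add: power_mult_distrib flip: exp_double)
  ultimately have "exp (- (4 * \<tau>)) * (norm x)\<^sup>2 \<le> (norm E)\<^sup>2"
    by simp
  then have lower: "(norm x)\<^sup>2 \<le> exp (4 * \<tau>) * (norm E)\<^sup>2"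
    by (simp add: exp_minus divide_simps mult.commute)
  have x: "0 < (norm x)\<^sup>2" using assms(5) by simp
  \<comment> \<open>Positivity carries over from \<open>norm x\<close>, which permits clearing the
    denominator in the second quotient.\<close>
  then have E: "0 < (norm E)\<^sup>2"
    using lower by (smt (verit) exp_gt_zero mult_nonneg_nonpos)
  have "(norm (E - P))\<^sup>2 \<le> e\<^sup>2 * (exp (4 * \<tau>) * (norm E)\<^sup>2)"
    using upper lower by (meson mult_left_mono order_trans zero_le_power2)
  then have "(norm (E - P))\<^sup>2 / (norm E)\<^sup>2 \<le> e\<^sup>2 * exp (4 * \<tau>)"
    using E by (simp add: pos_divide_le_eq mult.assoc)
  moreover have "(norm (E - P))\<^sup>2 / (norm x)\<^sup>2 \<le> e\<^sup>2"
    using upper x by (simp add: pos_divide_le_eq)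
  ultimately show ?thesis
    unfolding E_def P_def e_def by blast
qed

end
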